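(* Let $(m,\mathcal Z)$ be a balanced economy. Then a price vector is a Walrasian equilibrium of $(m,\mathcal Z)$ if and only if it is a scalar multiple, by a factor $\lambda\ge1$, of a strong solution of the variational inequality $([0,1]^m,-\mathcal Z)$; that is, $$\mathrm{WE}(m,\mathcal Z)=\bigcup_{\lambda\ge1}\lambda\,\mathrm{SVI}([0,1]^m,-\mathcal Z).$$
   Context: A Walrasian economy $(m,\mathcal Z)$ consists of $m\in\mathbb N$ commodities and an excess demand correspondence $\mathcal Z:\mathbb{R}^m_+\rightrightarrows\mathbb{R}^m$. It is balanced if (i) $\mathcal Z(\lambda p)=\mathcal Z(p)$ for all $\lambda>0$, $p\in\mathbb{R}^m_+$ (homogeneity of degree $0$), and (ii) $p\cdot z\le0$ for all $p\in\mathbb{R}^m_+$, $z\in\mathcal Z(p)$ (weak Walras' law). A Walrasian equilibrium is a $p^*\in\mathbb{R}^m_+$ for which there is $z\in\mathcal Z(p^* )$ with $z_j\le0$ for all $j$ and $p^*\cdot z=0$; $\mathrm{WE}(m,\mathcal Z)$ is the set of these. For $X\subseteq\mathbb{R}^m_+$, $\mathrm{SVI}(X,-\mathcal Z)$ is the set of strong solutions of the variational inequality $(X,-\mathcal Z)$: those $p^*\in X$ for which there is $z\in\mathcal Z(p^* )$ with $\langle z,p-p^*\rangle\le0$ for all $p\in X$. For a set $A$ and scalar $\lambda$, $\lambda A=\{\lambda a: a\in A\}$. *)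

theory Defs
  imports "HOL-Analysis.Analysis"
begin

text \<open>The commodities are the elements of the finite index type \<open>'m\<close>, so \<open>m = CARD('m)\<close>. An
  excess demand correspondence on the nonnegative orthant is a set-valued function (empty values
  allowed) on all of \<open>real ^ 'm\<close>; no definition below uses its values off the orthant.\<close>

definition orthant :: "(real ^ 'm) set" where
  "orthant = {p. \<forall>j. 0 \<le> p $ j}"

definition unit_cube :: "(real ^ 'm) set" where
  "unit_cube = {p. \<forall>j. 0 \<le> p $ j \<and> p $ j \<le> 1}"

definition balanced :: "(real ^ 'm \<Rightarrow> (real ^ 'm) set) \<Rightarrow> bool" where
  "balanced Z \<longleftrightarrow>
     (\<forall>l>0. \<forall>p\<in>orthant. Z (l *\<^sub>R p) = Z p) \<and>
     (\<forall>p\<in>orthant. \<forall>z\<in>Z p. p \<bullet> z \<le> 0)"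

definition WE :: "(real ^ 'm \<Rightarrow> (real ^ 'm) set) \<Rightarrow> (real ^ 'm) set" where
  "WE Z = {p \<in> orthant. \<exists>z\<in>Z p. (\<forall>j. z $ j \<le> 0) \<and> p \<bullet> z = 0}"

definition SVI ::
  "(real ^ 'm) set \<Rightarrow> (real ^ 'm \<Rightarrow> (real ^ 'm) set) \<Rightarrow> (real ^ 'm) set" where
  "SVI X F = {x \<in> X. \<exists>f\<in>F x. \<forall>y\<in>X. f \<bullet> (y - x) \<ge> 0}"

definition neg_corr ::
  "(real ^ 'm \<Rightarrow> (real ^ 'm) set) \<Rightarrow> real ^ 'm \<Rightarrow> (real ^ 'm) set" where
  "neg_corr Z p = uminus ` Z p"

lemma SVI_neg_corr:
  "SVI X (neg_corr Z) = {p \<in> X. \<exists>z\<in>Z p. \<forall>q\<in>X. z \<bullet> (q - p) \<le> 0}"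
  by (simp add: SVI_def neg_corr_def)

end

theory Submission
  imports Defs
begin

text \<open>Comparing a strong solution \<open>p\<close> with \<open>0\<close> gives \<open>p \<bullet> z \<ge> 0\<close>, hence \<open>p \<bullet> z = 0\<close> by Walras' law,
  and comparing it with the unit vectors then gives \<open>z \<le> 0\<close>; scaling \<open>p\<close> keeps both by homogeneity.
  Conversely, an equilibrium price is scaled down into the cube.\<close>

lemma unit_cube_subset_orthant: "unit_cube \<subseteq> orthant"
  by (auto simp: unit_cube_def orthant_def)

lemma inner_nonneg_nonpos:
  fixes z q :: "real ^ 'm"
  assumes "\<And>j. z $ j \<le> 0" and "\<And>j. 0 \<le> q $ j"
  shows "z \<bullet> q \<le> 0"
  using assms by (simp add: inner_vec_def mult_nonpos_nonneg sum_nonpos)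

lemma SVI_unit_cube_subset_WE:
  fixes Z :: "real ^ 'm \<Rightarrow> (real ^ 'm) set"
  assumes "balanced Z"
  shows "SVI unit_cube (neg_corr Z) \<subseteq> WE Z"
proof
  fix p assume "p \<in> SVI unit_cube (neg_corr Z)"
  then obtain z where p: "p \<in> unit_cube" and z: "z \<in> Z p"
    and vi: "\<And>q. q \<in> unit_cube \<Longrightarrow> z \<bullet> (q - p) \<le> 0"
    by (auto simp: SVI_neg_corr)
  have orth: "p \<in> orthant"
    using p unit_cube_subset_orthant by blast
  have "z \<bullet> p \<ge> 0"
    using vi[of 0] by (simp add: unit_cube_def)
  moreover have "p \<bullet> z \<le> 0"
    using assms orth z by (auto simp: balanced_def)
  ultimately have zp: "p \<bullet> z = 0"
    by (simp add: inner_commute)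
  have "z $ j \<le> 0" for j
    \<comment> \<open>Since \<open>p \<bullet> z = 0\<close>, testing against the unit vector leaves
      exactly \<open>z $ j\<close>. Membership of that vector in the cube is checked by unfolding
      \<open>axis\<close>, so \<open>inner_axis\<close> is supplied in unfolded form too.\<close>
    using vi[of "axis j 1"] zp
    by (simp add: unit_cube_def axis_def inner_diff_right inner_commute[of z p]
        inner_axis[of z j 1, unfolded axis_def])
  with orth z zp show "p \<in> WE Z"
    by (auto simp: WE_def)
qed

text \<open>The same \<open>z\<close> is a witness at both prices. Both inclusions rely on this: one
  shrinks an equilibrium into the cube, the other stretches a solution out of it.\<close>

lemma WE_scaleR:
  fixes Z :: "real ^ 'm \<Rightarrow> (real ^ 'm) set"
  assumes "balanced Z" and "p \<in> WE Z" and "l > 0"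
  shows "l *\<^sub>R p \<in> WE Z"
  using assms by (auto simp: WE_def balanced_def orthant_def)

text \<open>As \<open>p \<bullet> z = 0\<close>, the variational inequality reduces to
  \<open>z \<bullet> q \<le> 0\<close>, a nonpositive vector against a nonnegative one.\<close>

lemma WE_Int_unit_cube_subset_SVI:
  fixes Z :: "real ^ 'm \<Rightarrow> (real ^ 'm) set"
  shows "WE Z \<inter> unit_cube \<subseteq> SVI unit_cube (neg_corr Z)"
proof
  fix p assume "p \<in> WE Z \<inter> unit_cube"
  then obtain z where p: "p \<in> unit_cube" and z: "z \<in> Z p" "\<And>j. z $ j \<le> 0" "p \<bullet> z = 0"
    by (auto simp: WE_def)
  have "z \<bullet> (q - p) \<le> 0" if "q \<in> unit_cube" for q
    using inner_nonneg_nonpos[of z q] that z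
    by (simp add: unit_cube_def inner_diff_right inner_commute[of z p])
  with p z show "p \<in> SVI unit_cube (neg_corr Z)"
    by (auto simp: SVI_neg_corr)
qed

lemma scaleR_into_unit_cube:
  fixes p :: "real ^ 'm"
  assumes "p \<in> orthant"
  shows "(1 / (1 + norm p)) *\<^sub>R p \<in> unit_cube"
proof -
  have "p $ j \<le> 1 + norm p" for j
    using component_le_norm_cart[of p j] by linarith
  moreover have "1 + norm p > 0"
    by (simp add: add_pos_nonneg)
  ultimately show ?thesis
    using assms by (auto simp: unit_cube_def orthant_def divide_simps)
qed

theorem theorem4p2:
  fixes Z :: "real ^ 'm \<Rightarrow> (real ^ 'm) set"
  assumes "balanced Z"
  shows "WE Z = (\<Union>l\<in>{1::real..}. (*\<^sub>R) l ` SVI unit_cube (neg_corr Z))"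
proof (intro equalityI subsetI)
  fix p assume p: "p \<in> WE Z"
  \<comment> \<open>The norm bounds every coordinate of \<open>p\<close>, so dividing by
    \<open>l\<close> lands in the cube. The summand 1 secures \<open>l \<ge> 1\<close>, the range of
    the union, and covers \<open>p = 0\<close>.\<close>
  define l where "l = 1 + norm p"
  have l: "l \<ge> 1"
    by (simp add: l_def)
  have "p \<in> orthant"
    using p by (simp add: WE_def)
  then have "(1 / l) *\<^sub>R p \<in> unit_cube"
    unfolding l_def by (rule scaleR_into_unit_cube)
  moreover have "(1 / l) *\<^sub>R p \<in> WE Z"
    using WE_scaleR[OF assms p, of "1 / l"] l by simp
  ultimately have "(1 / l) *\<^sub>R p \<in> SVI unit_cube (neg_corr Z)"
    using WE_Int_unit_cube_subset_SVI by blast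
  moreover have "p = l *\<^sub>R ((1 / l) *\<^sub>R p)"
    using l by simp
  ultimately show "p \<in> (\<Union>l\<in>{1::real..}. (*\<^sub>R) l ` SVI unit_cube (neg_corr Z))"
    using l by blast
next
  fix p assume "p \<in> (\<Union>l\<in>{1::real..}. (*\<^sub>R) l ` SVI unit_cube (neg_corr Z))"
  then obtain l q where "l \<ge> 1" "q \<in> SVI unit_cube (neg_corr Z)" "p = l *\<^sub>R q"
    by auto
  then show "p \<in> WE Z"
    using WE_scaleR[OF assms, of q l] SVI_unit_cube_subset_WE[OF assms] by auto
qed

end
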